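(* Let $k\in\mathbb{N}$ and $N=pq$ where $p,q$ are odd primes with $p\neq q$. Let $m\in\mathbb{N}$ be coprime to $N$ with $\left(\frac{m}{p}\right)_{2^{k-1}}=\left(\frac{m}{q}\right)_{2^{k-1}}=1$. Let $\phi_m$ be the permutation of $\mathbb{Z}_N$ given by $x\bmod N\mapsto mx\bmod N$. Then \[ \left(\frac{m}{N}\right)_{2^k}=\begin{cases}\operatorname{sgn}\left(\phi_m|_{\mathbb{Z}_{N,2^{k-1}}}\right) & \text{if } N\equiv 1 \pmod{2^k},\\[2pt] \operatorname{sgn}\left(\phi_m|_{\mathbb{Z}_{N,2^{k-1}}^*}\right) & \text{if } N\not\equiv 1\pmod{2^k}.\end{cases} \]
   Context: For $k\in\mathbb{N}_0$, a prime $p$ and $a\in\mathbb{Z}$ with $p\nmid a$, $\left(\frac{a}{p}\right)_{2^k}=1$ if there is $x\in\mathbb{Z}$ with $x^{2^k}\equiv a \pmod p$, and $-1$ otherwise; for $n=p_1\cdots p_l$ (primes not necessarily distinct) with $\gcd(n,a)=1$, $\left(\frac{a}{n}\right)_{2^k}:=\prod_i\left(\frac{a}{p_i}\right)_{2^k}$. For $n\in\mathbb{N}$, $j\in\mathbb{N}_0$: $\mathbb{Z}_{n,2^j}:=\{r\in\mathbb{Z}_n:\exists x\in\mathbb{Z},\ x^{2^j}\equiv r\pmod n\}$ and $\mathbb{Z}_{n,2^j}^*$ is the set of units of $\mathbb{Z}_n$ that are $2^j$-th powers modulo $n$. Under the hypotheses, multiplication by $m$ maps each of these sets (for $n=N$,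 $j=k-1$) bijectively to itself, so the restrictions are permutations. *)

theory Defs
  imports "HOL-Number_Theory.Number_Theory" "HOL-Combinatorics.Permutations"
begin

definition pow2_symbol_prime :: "nat \<Rightarrow> int \<Rightarrow> nat \<Rightarrow> int" where
  "pow2_symbol_prime k a p = (if \<exists>x::int. [x ^ (2 ^ k) = a] (mod int p) then 1 else -1)"

definition pow2_symbol :: "nat \<Rightarrow> int \<Rightarrow> nat \<Rightarrow> int" where
  "pow2_symbol k a n = (\<Prod>p\<in>#prime_factorization n. pow2_symbol_prime k a p)"

definition pow2_residues :: "nat \<Rightarrow> nat \<Rightarrow> int set" where
  "pow2_residues n j =
     {r \<in> carrier (residue_ring (int n)). \<exists>x::int. [x ^ (2 ^ j) = r] (mod int n)}"

definition pow2_unit_residues :: "nat \<Rightarrow> nat \<Rightarrow> int set" where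
  "pow2_unit_residues n j =
     {r \<in> Units (residue_ring (int n)). \<exists>x::int. [x ^ (2 ^ j) = r] (mod int n)}"

definition residue_mult :: "nat \<Rightarrow> nat \<Rightarrow> int \<Rightarrow> int" where
  "residue_mult m n x = (int m * x) mod int n"

text \<open>
  In HOL a permutation of a set is a function on the whole type that fixes every point outside
  the set, so restricting \<^const>\<open>residue_mult\<close> to a set \<open>S\<close> means taking
  \<open>restrict_id (residue_mult m n) S\<close>.  The lemmas below show that this is a permutation
  of \<open>S\<close> for the sets above, so that its \<^const>\<open>sign\<close> is meaningful.
\<close>

lemma residue_mult_permutes:
  assumes n: "n > 1" and cop: "coprime m n"
    and S: "S \<subseteq> carrier (residue_ring (int n))"
    and closed: "\<And>x. x \<in> S \<Longrightarrow> residue_mult m n x \<in> S"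
  shows "restrict_id (residue_mult m n) S permutes S"
proof -
  have fin: "finite S"
    using S by (rule finite_subset) (simp add: residue_ring_def)
  have "inj_on (residue_mult m n) S"
  proof (rule inj_onI)
    fix x y assume xy: "x \<in> S" "y \<in> S" and eq: "residue_mult m n x = residue_mult m n y"
    from eq have "[int m * x = int m * y] (mod int n)"
      by (simp add: residue_mult_def cong_def)
    with cop have "[x = y] (mod int n)"
      by (simp add: cong_mult_lcancel)
    moreover have "0 \<le> x" "x < int n" "0 \<le> y" "y < int n"
      using xy S by (auto simp: residue_ring_def)
    ultimately show "x = y"
      by (simp add: cong_def)
  qed
  moreover have "residue_mult m n ` S \<subseteq> S"
    using closed by blast
  ultimately have "bij_betw (residue_mult m n) S S"
    using fin by (simp add: bij_betw_def endo_inj_surj)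
  then have "bij_betw (restrict_id (residue_mult m n) S) S S"
    by (rule bij_betw_cong[THEN iffD1, rotated]) simp
  then show ?thesis
    by (rule bij_imp_permutes) simp
qed

lemma pow2_symbol_one_imp_power_residue:
  fixes p q m :: nat
  assumes pq: "prime p" "prime q" "p \<noteq> q"
    and "pow2_symbol_prime j (int m) p = 1" "pow2_symbol_prime j (int m) q = 1"
  obtains y :: int where "[y ^ (2 ^ j) = int m] (mod int (p * q))"
proof -
  obtain u v :: int where u: "[u ^ (2 ^ j) = int m] (mod int p)"
    and v: "[v ^ (2 ^ j) = int m] (mod int q)"
    using assms(4,5) by (auto simp: pow2_symbol_prime_def split: if_splits)
  have cop: "coprime (int p) (int q)"
    using pq by (simp add: primes_coprime)
  then obtain y where y: "[y = u] (mod int p)" "[y = v] (mod int q)"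
    using binary_chinese_remainder_int by blast
  have "[y ^ (2 ^ j) = int m] (mod int p)" "[y ^ (2 ^ j) = int m] (mod int q)"
    using cong_trans[OF cong_pow[OF y(1)] u] cong_trans[OF cong_pow[OF y(2)] v] by auto
  then have "[y ^ (2 ^ j) = int m] (mod int (p * q))"
    using cop by (simp add: coprime_cong_mult)
  then show ?thesis by (rule that)
qed

lemma residue_mult_power:
  assumes "[y ^ (2 ^ j) = int m] (mod int n)" and "\<exists>x::int. [x ^ (2 ^ j) = r] (mod int n)"
  shows "\<exists>x::int. [x ^ (2 ^ j) = residue_mult m n r] (mod int n)"
proof -
  from assms(2) obtain x :: int where "[x ^ (2 ^ j) = r] (mod int n)" by blast
  with assms(1) have "[(y * x) ^ (2 ^ j) = int m * r] (mod int n)"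
    by (simp add: power_mult_distrib cong_mult)
  then show ?thesis
    unfolding residue_mult_def cong_def by auto
qed

lemma
  fixes p q m :: nat
  assumes pq: "prime p" "prime q" "p \<noteq> q" and cop: "coprime m (p * q)"
    and sym: "pow2_symbol_prime j (int m) p = 1" "pow2_symbol_prime j (int m) q = 1"
  shows residue_mult_permutes_pow2_residues:
      "restrict_id (residue_mult m (p * q)) (pow2_residues (p * q) j)
         permutes pow2_residues (p * q) j" (is ?A)
    and residue_mult_permutes_pow2_unit_residues:
      "restrict_id (residue_mult m (p * q)) (pow2_unit_residues (p * q) j)
         permutes pow2_unit_residues (p * q) j" (is ?B)
proof -
  define n where "n = p * q"
  obtain y :: int where y: "[y ^ (2 ^ j) = int m] (mod int n)"
    using pow2_symbol_one_imp_power_residue[OF pq sym] unfolding n_def by blast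
  have n: "n > 1"
    unfolding n_def using pq by (metis less_1_mult prime_gt_1_nat)
  interpret residues "int n" "residue_ring (int n)"
    by unfold_locales (use n in auto)
  have c: "residue_mult m n x \<in> carrier (residue_ring (int n))" for x
    using n by (simp add: residue_ring_def residue_mult_def)
  have copn: "coprime m n" using cop by (simp add: n_def)
  have u: "residue_mult m n x \<in> Units (residue_ring (int n))"
    if "x \<in> Units (residue_ring (int n))" for x
  proof -
    have "coprime ((int m * x) mod int n) (int n)"
      using that copn by (simp add: res_units_eq coprime_mod_left_iff n flip: of_nat_mult)
    moreover from this have "(int m * x) mod int n \<noteq> 0"
      using n by (intro notI) (simp only: coprime_0_left_iff, simp)
    moreover have "(int m * x) mod int n \<ge> 0" "(int m * x) mod int n < int n"
      using n by auto
    ultimately show ?thesis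
      unfolding res_units_eq residue_mult_def mem_Collect_eq by linarith
  qed
  show ?A
    unfolding n_def[symmetric]
    by (rule residue_mult_permutes[OF n copn])
       (use c residue_mult_power[OF y] in \<open>auto simp: pow2_residues_def\<close>)
  show ?B
    unfolding n_def[symmetric]
    by (rule residue_mult_permutes[OF n copn])
       (use u residue_mult_power[OF y] in \<open>auto simp: pow2_unit_residues_def\<close>)
qed

end

theory Submission
  imports Defs
begin

text \<open>
  Put \<open>j = k - 1\<close> and let \<open>G\<^sub>p\<close>, \<open>G\<^sub>q\<close> be the cyclic groups of unit \<open>2\<^sup>j\<close>-th powers modulo \<open>p\<close> and \<open>q\<close>.
  If \<open>m\<close> is the \<open>e\<close>-th power of a generator of \<open>G\<^sub>p\<close>, multiplication by \<open>m\<close> on \<open>G\<^sub>p\<close> is the \<open>e\<close>-th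
  power of a cycle of length \<open>|G\<^sub>p|\<close>, so its sign is \<open>-1\<close> iff \<open>|G\<^sub>p|\<close> is even and \<open>e\<close> is odd, that is,
  iff \<open>m\<close> is not a square in \<open>G\<^sub>p\<close>. Hence the sign is the \<open>2\<^sup>k\<close>-th power symbol \<open>s\<close> of \<open>m\<close> modulo \<open>p\<close>,
  and \<open>s = 1\<close> if \<open>|G\<^sub>p|\<close> is odd; let \<open>t\<close> be the symbol modulo \<open>q\<close>. By the Chinese remainder theorem
  the sets modulo \<open>N\<close> are \<open>G\<^sub>p \<times> G\<^sub>q\<close> and \<open>(G\<^sub>p \<union> {0}) \<times> (G\<^sub>q \<union> {0})\<close>, on which the signs are
  \<open>s ^ |G\<^sub>q| * t ^ |G\<^sub>p|\<close> and \<open>s ^ (|G\<^sub>q| + 1) * t ^ (|G\<^sub>p| + 1)\<close>. Since \<open>|G\<^sub>p|\<close> is even iff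
  \<open>p \<equiv> 1\<close> modulo \<open>2\<^sup>k\<close>, comparing parities shows that the relevant sign is \<open>s * t\<close>.
\<close>

section \<open>Signs of permutations restricted to a set\<close>

text \<open>Signs are invariant under conjugation: \<open>h\<close> transports \<open>f\<close> on
  \<open>A\<close> to \<open>g\<close> on \<open>B\<close>. This serves for discrete logarithms,
  slices of products and Chinese remaindering alike.\<close>

lemma sign_on_bij_betw:
  assumes h: "bij_betw h A B" and f: "bij_betw f A A" and fin: "finite A"
    and comm: "\<And>x. x \<in> A \<Longrightarrow> g (h x) = h (f x)"
  shows "sign_on B g = sign_on A f"
proof -
  have inj: "inj_on h A" and B: "B = h ` A"
    using h by (auto simp: bij_betw_def)
  have "restrict_id g B = map_permutation A h (restrict_id f A)"
  proof
    fix y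
    show "restrict_id g B y = map_permutation A h (restrict_id f A) y"
    proof (cases "y \<in> B")
      case True
      then obtain x where x: "x \<in> A" "y = h x" using B by blast
      then show ?thesis
        using True comm[OF x(1)] map_permutation_apply[OF inj x(1), of "restrict_id f A"] by simp
    next
      case False
      then show ?thesis by (simp add: map_permutation_def B)
    qed
  qed
  then show ?thesis
    using sign_map_permutation[OF inj permutes_restrict_id[OF f] fin]
    by (simp add: sign_on_def)
qed

lemma sign_on_Un_disjoint:
  assumes f: "bij_betw f A A" "bij_betw f B B" and fin: "finite A" "finite B"
    and disj: "A \<inter> B = {}"
  shows "sign_on (A \<union> B) f = sign_on A f * sign_on B f"
proof -
  have "f x \<in> B" if "x \<in> B" for x
    using f(2) that by (auto simp: bij_betw_def)
  \<comment> \<open>A point of \<open>B\<close> is sent into \<open>B\<close>, hence outside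
    \<open>A\<close>, so the factor applied second leaves it alone.\<close>
  then have "restrict_id f (A \<union> B) = restrict_id f A \<circ> restrict_id f B"
    using disj by (fastforce simp: restrict_id_def fun_eq_iff)
  moreover have "permutation (restrict_id f A)" "permutation (restrict_id f B)"
    using f fin by (auto intro: permutes_imp_permutation permutes_restrict_id)
  ultimately show ?thesis
    by (simp add: sign_on_def sign_compose)
qed

lemma sign_on_funpow:
  assumes "bij_betw f A A" "finite A"
  shows "sign_on A (f ^^ i) = sign_on A f ^ i"
proof (induction i)
  case (Suc i)
  have "bij_betw (f ^^ i) A A"
    using assms(1) by (rule bij_betw_funpow)
  with Suc assms show ?case
    unfolding funpow.simps by (simp only: sign_on_compose power_Suc)
qed simp

section \<open>Signs on Cartesian products\<close>

lemma bij_betw_apfst_Times: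
  assumes "bij_betw f A A"
  shows "bij_betw (apfst f) (A \<times> B) (A \<times> B)"
  using bij_betw_map_prod[OF assms bij_betw_id[of B]] by (simp add: apfst_def)

text \<open>The product splits into the slices \<open>A \<times> {b}\<close>, each carrying a copy
  of \<open>f\<close>; every slice contributes one factor.\<close>

lemma sign_on_apfst_Times:
  assumes f: "bij_betw f A A" and fin: "finite A" "finite B"
  shows "sign_on (A \<times> B) (apfst f) = sign_on A f ^ card B"
  using fin(2)
proof (induction B rule: finite_induct)
  case empty
  then show ?case by (simp add: sign_on_def restrict_id_def)
next
  case (insert b B)
  have split: "A \<times> insert b B = A \<times> {b} \<union> A \<times> B" by auto
  have "sign_on (A \<times> {b}) (apfst f) = sign_on A f"
    by (rule sign_on_bij_betw[where h = "\<lambda>x. (x, b)", OF _ f fin(1)])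
       (auto simp: bij_betw_def inj_on_def)
  moreover have "sign_on (A \<times> insert b B) (apfst f)
      = sign_on (A \<times> {b}) (apfst f) * sign_on (A \<times> B) (apfst f)"
    unfolding split
    by (rule sign_on_Un_disjoint) (use insert fin bij_betw_apfst_Times[OF f] in auto)
  ultimately show ?case
    using insert by simp
qed

text \<open>\<open>map_prod f g\<close> acts on one coordinate after the other, and swapping
  coordinates reduces the action on the second to that on the first.\<close>

lemma sign_on_map_prod_Times:
  assumes f: "bij_betw f A A" and g: "bij_betw g B B" and fin: "finite A" "finite B"
  shows "sign_on (A \<times> B) (map_prod f g) = sign_on A f ^ card B * sign_on B g ^ card A"
proof -
  have bg: "bij_betw (apsnd g) (A \<times> B) (A \<times> B)"
    using bij_betw_map_prod[OF bij_betw_id[of A] g] by (simp add: apsnd_def)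
  have "sign_on (A \<times> B) (apsnd g) = sign_on (B \<times> A) (apfst g)"
    by (rule sign_on_bij_betw[where h = prod.swap, OF _ bij_betw_apfst_Times[OF g]])
       (use fin in \<open>auto simp: bij_betw_def\<close>)
  moreover have "map_prod f g = apfst f \<circ> apsnd g"
    by (simp add: fun_eq_iff)
  ultimately show ?thesis
    using sign_on_compose[OF bij_betw_apfst_Times[OF f] bg] fin
    by (simp add: sign_on_apfst_Times f g)
qed

section \<open>Cyclic shifts of an initial segment of the naturals\<close>

lemma bij_betw_rotation: "bij_betw (\<lambda>i. Suc i mod n) {..<n} {..<n}"
proof -
  have "inj_on (\<lambda>i. Suc i mod n) {..<n}"
    by (rule inj_onI) (auto simp: mod_Suc split: if_splits)
  moreover have "(\<lambda>i. Suc i mod n) ` {..<n} \<subseteq> {..<n}" by auto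
  ultimately show ?thesis
    by (simp add: bij_betw_def endo_inj_surj)
qed

lemma sign_on_rotation: "sign_on {..<Suc n} (\<lambda>i. Suc i mod Suc n) = (-1) ^ n"
proof (induction n)
  case 0
  have "sign_on {..<Suc 0} (\<lambda>i. Suc i mod Suc 0) = sign_on {..<Suc 0} (\<lambda>i. i)"
    by (rule sign_on_cong) auto
  then show ?case by simp
next
  case (Suc n)
  define r where "r = restrict_id (\<lambda>i. Suc i mod Suc n) {..<Suc n}"
  have r: "r permutes {..<Suc n}"
    unfolding r_def by (intro permutes_restrict_id bij_betw_rotation)
  \<comment> \<open>The longer cycle arises from the shorter by one transposition: \<open>r\<close>
    sends \<open>n\<close> to 0, which is redirected to \<open>Suc n\<close>, while
    \<open>Suc n\<close>, fixed by \<open>r\<close>, goes to 0.\<close>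
  have "restrict_id (\<lambda>i. Suc i mod Suc (Suc n)) {..<Suc (Suc n)} = transpose 0 (Suc n) \<circ> r"
    by (auto simp: fun_eq_iff r_def restrict_id_def transpose_def mod_Suc)
  moreover have "permutation r"
    using r by (rule permutes_imp_permutation[rotated]) simp
  ultimately show ?case
    using Suc by (simp add: sign_on_def sign_compose permutation_swap_id sign_swap_id r_def)
qed

lemma funpow_rotation: "x < n \<Longrightarrow> ((\<lambda>i. Suc i mod n) ^^ k) x = (x + k) mod n"
  by (induction k) (auto simp: mod_Suc_eq)

lemma bij_betw_shift: "bij_betw (\<lambda>x. (x + k) mod n) {..<n} {..<(n::nat)}"
  using bij_betw_funpow[OF bij_betw_rotation, of k n]
  by (rule bij_betw_cong[THEN iffD1, rotated]) (simp add: funpow_rotation)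

text \<open>A shift by \<open>k\<close> is the \<open>k\<close>-th power of the cycle of length
  \<open>n\<close>, whose sign is \<open>(-1) ^ (n - 1)\<close>.\<close>

lemma sign_on_shift:
  assumes "n > 0"
  shows "sign_on {..<n} (\<lambda>x. (x + k) mod n) = (-1) ^ ((n - 1) * k)"
proof -
  have "sign_on {..<n} (\<lambda>x. (x + k) mod n) = sign_on {..<n} ((\<lambda>i. Suc i mod n) ^^ k)"
    by (rule sign_on_cong) (simp_all add: funpow_rotation)
  also have "\<dots> = (-1) ^ ((n - 1) * k)"
    using sign_on_funpow[OF bij_betw_rotation, of n k] sign_on_rotation[of "n - 1"] assms
    by (simp add: power_mult)
  finally show ?thesis .
qed

section \<open>Power residues modulo a prime\<close>

lemma pow2_residues_eq:
  "pow2_residues n j = {r \<in> {0..<int n}. \<exists>x::int. [x ^ 2 ^ j = r] (mod int n)}"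
  by (auto simp: pow2_residues_def residue_ring_def)

lemma pow2_unit_residues_eq:
  assumes "n > 1"
  shows "pow2_unit_residues n j
    = {r \<in> {0..<int n}. coprime r (int n) \<and> (\<exists>x::int. [x ^ 2 ^ j = r] (mod int n))}"
proof -
  interpret residues "int n" "residue_ring (int n)"
    by unfold_locales (use assms in auto)
  have "Units (residue_ring (int n)) = {r \<in> {0..<int n}. coprime r (int n)}"
    using assms unfolding res_units_eq by (auto simp: le_less)
  then show ?thesis by (auto simp: pow2_unit_residues_def)
qed

lemma pow2_residues_subset: "pow2_residues n j \<subseteq> {0..<int n}"
  by (auto simp: pow2_residues_eq)

lemma pow2_unit_residues_subset: "n > 1 \<Longrightarrow> pow2_unit_residues n j \<subseteq> {0..<int n}"
  by (auto simp: pow2_unit_residues_eq)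

lemma finite_pow2_unit_residues: "n > 1 \<Longrightarrow> finite (pow2_unit_residues n j)"
  using finite_subset[OF pow2_unit_residues_subset] by blast

text \<open>Modulo a prime only 0 fails to be a unit, and 0 is a power of itself because the
  exponent \<open>2 ^ j\<close> is positive.\<close>

lemma pow2_residues_prime:
  assumes "prime p"
  shows "pow2_residues p j = insert 0 (pow2_unit_residues p j)" "0 \<notin> pow2_unit_residues p j"
proof -
  have p: "p > 1" using assms by (rule prime_gt_1_nat)
  have "coprime r (int p)" if "0 \<le> r" "r < int p" "r \<noteq> 0" for r
  proof -
    have "\<not> int p dvd r" using that zdvd_not_zless[of r "int p"] by auto
    then show ?thesis
      using assms prime_imp_coprime[of "int p" r] by (simp add: coprime_commute)
  qed
  moreover have "\<exists>x::int. [x ^ 2 ^ j = 0] (mod int p)"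
    by (intro exI[of _ 0]) (simp add: zero_power)
  ultimately show "pow2_residues p j = insert 0 (pow2_unit_residues p j)"
    using p by (auto simp: pow2_residues_eq pow2_unit_residues_eq)
  show "0 \<notin> pow2_unit_residues p j"
    using p by (simp add: pow2_unit_residues_eq)
qed

text \<open>Take \<open>h = g ^ d\<close> for a primitive root \<open>g\<close>: its powers are the
  unit \<open>d\<close>-th powers, and raising to the power \<open>d\<close> divides the order
  \<open>p - 1\<close> by \<open>gcd d (p - 1)\<close>.\<close>

lemma prime_power_residue_generator:
  fixes p d :: nat
  assumes p: "prime p" and d: "d > 0"
  obtains h :: nat where "coprime p h" "ord p h * gcd d (p - 1) = p - 1"
    "\<And>r::int. coprime r (int p) \<Longrightarrow>
      (\<exists>x. [x ^ d = r] (mod int p)) \<longleftrightarrow> (\<exists>i. [int h ^ i = r] (mod int p))"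
proof -
  have p1: "p > 1" using p by (rule prime_gt_1_nat)
  obtain g where g: "residue_primroot p g"
    using prime_primitive_root_exists[of p] p p1 by auto
  then have ord_g: "ord p g = p - 1" and cop: "coprime p g"
    using p by (auto simp: residue_primroot_def totient_prime)
  have "(\<exists>x. [x ^ d = r] (mod int p)) \<longleftrightarrow> (\<exists>i. [int (g ^ d) ^ i = r] (mod int p))"
    if r: "coprime r (int p)" for r
  proof
    assume "\<exists>x. [x ^ d = r] (mod int p)"
    then obtain x where x: "[x ^ d = r] (mod int p)" by blast
    then have "coprime (x ^ d) (int p)"
      using r cong_imp_coprime cong_sym by blast
    \<comment> \<open>The primitive root generates \<open>totatives p\<close>, a set of naturals, so
      \<open>x\<close> is first replaced by its least nonnegative residue.\<close>
    then have cop_x: "coprime (x mod int p) (int p)"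
      using d p1 by (simp add: coprime_mod_left_iff)
    have "0 \<le> x mod int p" using p1 by simp
    then obtain n where n: "x mod int p = int n" by (rule nonneg_int_cases)
    have "n < p" using n p1 by (metis of_nat_0_less_iff of_nat_less_iff order_less_trans pos_mod_bound zero_less_one)
    moreover have "coprime n p" using cop_x by (simp add: n)
    moreover from this have "n > 0" using p1 by (intro gr0I) simp
    ultimately have "n \<in> totatives p" by (simp add: totatives_def)
    then obtain i where "n = g ^ i mod p"
      using residue_primroot_is_generator[OF p1 g] by (auto simp: bij_betw_def)
    then have "x mod int p = int (g ^ i) mod int p"
      using n by (simp add: zmod_int)
    then have "[int (g ^ i) = x] (mod int p)" by (simp add: cong_def)
    then have "[int (g ^ i) ^ d = r] (mod int p)"
      using cong_trans[OF cong_pow x] by blast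
    then have "[int (g ^ d) ^ i = r] (mod int p)"
      by (simp add: power_mult[symmetric] mult.commute)
    then show "\<exists>i. [int (g ^ d) ^ i = r] (mod int p)" by blast
  next
    assume "\<exists>i. [int (g ^ d) ^ i = r] (mod int p)"
    then obtain i where "[int (g ^ d) ^ i = r] (mod int p)" by blast
    then have "[(int g ^ i) ^ d = r] (mod int p)"
      by (simp add: power_mult[symmetric] mult.commute)
    then show "\<exists>x. [x ^ d = r] (mod int p)" by blast
  qed
  with that[of "g ^ d"] cop ord_power_aux[of p g d] show ?thesis
    by (simp add: ord_g)
qed

text \<open>This is the discrete exponential to base \<open>h\<close>; exponents matter only modulo
  the order of \<open>h\<close>, so those below it suffice.\<close>

lemma bij_betw_pow2_unit_residues_prime:
  fixes p h :: nat
  assumes p: "prime p" and cop: "coprime p h"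
    and h: "\<And>r::int. coprime r (int p) \<Longrightarrow>
      (\<exists>x. [x ^ 2 ^ j = r] (mod int p)) \<longleftrightarrow> (\<exists>i. [int h ^ i = r] (mod int p))"
  shows "bij_betw (\<lambda>i. int (h ^ i mod p)) {..<ord p h} (pow2_unit_residues p j)"
proof -
  have p1: "p > 1" using p by (rule prime_gt_1_nat)
  have cop_pow: "coprime (int (h ^ i mod p)) (int p)" for i
    using cop p1 by (simp add: coprime_commute coprime_mod_left_iff)
  have "inj_on (\<lambda>i. int (h ^ i mod p)) {..<ord p h}"
    using inj_power_mod[OF cop] by (auto simp: inj_on_def)
  moreover have "int (h ^ i mod p) \<in> pow2_unit_residues p j" for i
  proof -
    have "[int h ^ i = int (h ^ i mod p)] (mod int p)"
      by (simp add: cong_def zmod_int)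
    then have "\<exists>x. [x ^ 2 ^ j = int (h ^ i mod p)] (mod int p)"
      using h[OF cop_pow] by blast
    then show ?thesis
      unfolding pow2_unit_residues_eq[OF p1] using cop_pow[of i] p1 by simp
  qed
  moreover have "r \<in> (\<lambda>i. int (h ^ i mod p)) ` {..<ord p h}"
    if "r \<in> pow2_unit_residues p j" for r
  proof -
    have r: "0 \<le> r" "r < int p" "coprime r (int p)" "\<exists>x. [x ^ 2 ^ j = r] (mod int p)"
      using that p1 by (auto simp: pow2_unit_residues_eq)
    then obtain i where i: "[int h ^ i = r] (mod int p)" using h by blast
    have "[h ^ i = h ^ (i mod ord p h)] (mod p)"
      using cop by (simp add: order_divides_expdiff)
    then have "int (h ^ (i mod ord p h) mod p) = int h ^ i mod int p"
      by (metis cong_def of_nat_power zmod_int)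
    also have "\<dots> = r"
      using i r by (simp add: cong_def)
    finally show ?thesis
      using cop by (intro image_eqI[of _ _ "i mod ord p h"]) auto
  qed
  ultimately show ?thesis
    unfolding bij_betw_def by blast
qed

text \<open>The gcd removes at most \<open>j\<close> factors 2 from \<open>n\<close>, so a factor 2
  is left in \<open>a\<close> exactly when \<open>n\<close> has more than \<open>j\<close> of them.
  It is applied with \<open>n = p - 1\<close> and \<open>a\<close> the order of the
  generator.\<close>

lemma even_cofactor_gcd_pow2_iff:
  fixes a n :: nat
  assumes "a * gcd (2 ^ j) n = n"
  shows "even a \<longleftrightarrow> 2 ^ Suc j dvd n"
proof
  assume "2 ^ Suc j dvd n"
  then have "gcd (2 ^ j) n = 2 ^ j"
    by (metis dvd_trans gcd_nat.absorb1 le_imp_power_dvd lessI less_imp_le)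
  then show "even a"
    using assms \<open>2 ^ Suc j dvd n\<close> by auto
next
  assume "even a"
  obtain i where i: "i \<le> j" "gcd (2 ^ j) n = 2 ^ i"
    using divides_primepow_nat[of 2 "gcd (2 ^ j) n" j] by auto
  have dvd: "2 ^ Suc i dvd n"
    using \<open>even a\<close> assms i by (metis dvd_refl mult_dvd_mono power_Suc)
  \<comment> \<open>If \<open>i < j\<close>, then \<open>2 ^ Suc i\<close> would divide both
    \<open>n\<close> and \<open>2 ^ j\<close>, hence their gcd \<open>2 ^ i\<close>.\<close>
  have "i = j"
  proof (rule ccontr)
    assume "i \<noteq> j"
    then have "2 ^ Suc i dvd (2 ^ j :: nat)"
      using i by (intro le_imp_power_dvd) auto
    then have "2 ^ Suc i dvd (2 ^ i :: nat)"
      using dvd i by (metis gcd_greatest)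
    then show False
      by (auto dest: dvd_imp_le)
  qed
  then show "2 ^ Suc j dvd n" using dvd by simp
qed

lemma even_card_pow2_unit_residues_iff:
  assumes p: "prime p"
  shows "even (card (pow2_unit_residues p j)) \<longleftrightarrow> [p = 1] (mod 2 ^ Suc j)"
proof -
  obtain h where h: "coprime p h" "ord p h * gcd (2 ^ j) (p - 1) = p - 1"
    "\<And>r::int. coprime r (int p) \<Longrightarrow>
      (\<exists>x. [x ^ 2 ^ j = r] (mod int p)) \<longleftrightarrow> (\<exists>i. [int h ^ i = r] (mod int p))"
    by (rule prime_power_residue_generator[OF p, of "2 ^ j"]) auto
  have "card (pow2_unit_residues p j) = ord p h"
    using bij_betw_same_card[OF bij_betw_pow2_unit_residues_prime[OF p h(1,3)]] by simp
  then show ?thesis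
    using even_cofactor_gcd_pow2_iff[OF h(2)] prime_gt_1_nat[OF p]
    by (simp add: cong_altdef_nat)
qed

lemma sign_on_pow2_unit_residues_prime:
  assumes p: "prime p" and m: "coprime m p" and sym: "pow2_symbol_prime j (int m) p = 1"
  shows "sign_on (pow2_unit_residues p j) (residue_mult m p) = pow2_symbol_prime (Suc j) (int m) p"
      (is ?symbol)
    and "odd (card (pow2_unit_residues p j)) \<Longrightarrow>
      sign_on (pow2_unit_residues p j) (residue_mult m p) = 1"
      (is "_ \<Longrightarrow> ?one")
proof -
  have p1: "p > 1" using p by (rule prime_gt_1_nat)
  obtain h where h: "coprime p h"
    "\<And>r::int. coprime r (int p) \<Longrightarrow>
      (\<exists>x. [x ^ 2 ^ j = r] (mod int p)) \<longleftrightarrow> (\<exists>i. [int h ^ i = r] (mod int p))"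
    by (rule prime_power_residue_generator[OF p, of "2 ^ j"]) auto
  define a where "a = ord p h"
  have a: "a > 0" using h(1) by (simp add: a_def)
  have m': "coprime (int m) (int p)" using m by simp
  have "\<exists>x. [x ^ 2 ^ j = int m] (mod int p)"
    using sym by (auto simp: pow2_symbol_prime_def split: if_splits)
  then obtain e where "[int h ^ e = int m] (mod int p)"
    using h(2)[OF m'] by blast
  then have e: "[h ^ e = m] (mod p)"
    by (simp flip: cong_int_iff)
  have "sign_on (pow2_unit_residues p j) (residue_mult m p)
      = sign_on {..<a} (\<lambda>i. (i + e) mod a)"
  \<comment> \<open>In discrete logarithms, multiplication by \<open>m\<close>, which is
    \<open>h ^ e\<close> modulo \<open>p\<close>, becomes the shift by \<open>e\<close> modulo
    \<open>a\<close>.\<close>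
  proof (rule sign_on_bij_betw[OF bij_betw_pow2_unit_residues_prime[OF p h, folded a_def]
        bij_betw_shift finite_lessThan])
    fix i
    have "[m * h ^ i = h ^ e * h ^ i] (mod p)"
      using e by (intro cong_mult) (auto simp: cong_sym)
    also have "h ^ e * h ^ i = h ^ (i + e)" by (simp add: power_add)
    also have "[\<dots> = h ^ ((i + e) mod a)] (mod p)"
      using h(1) by (simp add: order_divides_expdiff a_def)
    finally have "m * (h ^ i mod p) mod p = h ^ ((i + e) mod a) mod p"
      by (simp add: cong_def mod_mult_right_eq)
    then show "residue_mult m p (int (h ^ i mod p)) = int (h ^ ((i + e) mod a) mod p)"
      unfolding residue_mult_def by (metis of_nat_mult zmod_int)
  qed
  also have "\<dots> = (-1) ^ ((a - 1) * e)"
    using a by (rule sign_on_shift)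
  also have "\<dots> = (if odd a \<or> even e then 1 else -1)"
    using a by auto
  finally have sign: "sign_on (pow2_unit_residues p j) (residue_mult m p)
      = (if odd a \<or> even e then 1 else -1)" .
  have "card (pow2_unit_residues p j) = a"
    using bij_betw_same_card[OF bij_betw_pow2_unit_residues_prime[OF p h]] by (simp add: a_def)
  then show "odd (card (pow2_unit_residues p j)) \<Longrightarrow> ?one"
    by (simp add: sign)
  have "odd a \<or> even e \<longleftrightarrow> (\<exists>x::int. [x ^ 2 ^ Suc j = int m] (mod int p))"
  proof -
    \<comment> \<open>A \<open>2 ^ Suc j\<close>-th power is the square of a \<open>2 ^ j\<close>-th
      power, that is, of some \<open>h ^ i\<close>; comparing exponents modulo \<open>a\<close>
      makes the question linear.\<close>
    have "(\<exists>x::int. [x ^ 2 ^ Suc j = int m] (mod int p)) \<longleftrightarrow> (\<exists>i. [2 * i = e] (mod a))"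
    proof
      assume "\<exists>x::int. [x ^ 2 ^ Suc j = int m] (mod int p)"
      then obtain x :: int where x: "[(x ^ 2 ^ j)\<^sup>2 = int m] (mod int p)"
        by (auto simp: power_mult[symmetric] mult.commute)
      then have "coprime ((x ^ 2 ^ j)\<^sup>2) (int p)"
        using m' cong_imp_coprime cong_sym by blast
      then have "coprime (x ^ 2 ^ j) (int p)" by simp
      then obtain i where i: "[int h ^ i = x ^ 2 ^ j] (mod int p)"
        using h(2) cong_refl by blast
      have "[(int h ^ i)\<^sup>2 = int m] (mod int p)"
        using cong_trans[OF cong_pow[OF i] x] .
      then have "[h ^ (2 * i) = m] (mod p)"
        by (simp add: power_mult[symmetric] mult.commute flip: cong_int_iff)
      then have "[h ^ (2 * i) = h ^ e] (mod p)"
        using e cong_trans cong_sym by blast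
      then show "\<exists>i. [2 * i = e] (mod a)"
        using h(1) by (auto simp: order_divides_expdiff a_def)
    next
      assume "\<exists>i. [2 * i = e] (mod a)"
      then obtain i where "[2 * i = e] (mod a)" by blast
      then have "[h ^ (2 * i) = h ^ e] (mod p)"
        using h(1) by (simp add: order_divides_expdiff a_def)
      then have "[h ^ (2 * i) = m] (mod p)"
        using e by (rule cong_trans)
      then have i: "[(int h ^ i)\<^sup>2 = int m] (mod int p)"
        by (simp add: power_mult[symmetric] mult.commute flip: cong_int_iff)
      have "coprime (int h ^ i) (int p)"
        using h(1) by (simp add: coprime_commute)
      then obtain x where "[x ^ 2 ^ j = int h ^ i] (mod int p)"
        using h(2) cong_refl by blast
      then have "[(x ^ 2 ^ j)\<^sup>2 = int m] (mod int p)"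
        using i cong_pow cong_trans by blast
      then show "\<exists>x::int. [x ^ 2 ^ Suc j = int m] (mod int p)"
        by (auto simp: power_mult[symmetric] mult.commute)
    qed
    also have "\<dots> \<longleftrightarrow> odd a \<or> even e"
    proof
      assume "\<exists>i. [2 * i = e] (mod a)"
      then show "odd a \<or> even e"
        by (metis cong_dvd_modulus_nat cong_dvd_iff dvd_triv_left)
    next
      assume *: "odd a \<or> even e"
      show "\<exists>i. [2 * i = e] (mod a)"
      proof (cases "even e")
        case True
        then show ?thesis by (metis cong_refl evenE)
      next
        case False
        \<comment> \<open>Here \<open>a\<close> and \<open>e\<close> are both odd, so half of
          \<open>e + a\<close> solves the congruence.\<close>
        with * have "even (e + a)" by simp
        then obtain i where "e + a = 2 * i" by (elim evenE)
        then have "[2 * i = e] (mod a)" by (metis cong_add_rcancel_0_nat cong_def mod_add_self2)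
        then show ?thesis by blast
      qed
    qed
    finally show ?thesis by blast
  qed
  then show ?symbol by (simp add: sign pow2_symbol_prime_def)
qed

text \<open>The added point 0 is fixed by multiplication.\<close>

lemma sign_on_pow2_residues_prime:
  assumes "prime p"
  shows "sign_on (pow2_residues p j) (residue_mult m p)
    = sign_on (pow2_unit_residues p j) (residue_mult m p)"
proof -
  have "restrict_id (residue_mult m p) (pow2_residues p j)
      = restrict_id (residue_mult m p) (pow2_unit_residues p j)"
    using pow2_residues_prime[OF assms, of j]
    by (auto simp: fun_eq_iff restrict_id_def residue_mult_def)
  then show ?thesis by (simp add: sign_on_def)
qed

section \<open>Chinese remaindering\<close>

text \<open>Injectivity is uniqueness modulo \<open>p * q\<close>; surjectivity reduces a common
  solution \<open>y\<close> to its representative, whose membership in \<open>S\<close> is decided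
  by its two residues.\<close>

lemma bij_betw_chinese_remainder:
  fixes p q :: nat
  assumes pq: "p > 0" "q > 0" and cop: "coprime p q"
    and sub: "S \<subseteq> {0..<int (p * q)}" "A \<subseteq> {0..<int p}" "B \<subseteq> {0..<int q}"
    and S: "\<And>r. r \<in> {0..<int (p * q)} \<Longrightarrow> r \<in> S \<longleftrightarrow> r mod int p \<in> A \<and> r mod int q \<in> B"
  shows "bij_betw (\<lambda>r. (r mod int p, r mod int q)) S (A \<times> B)"
proof -
  have cop': "coprime (int p) (int q)" using cop by simp
  have "inj_on (\<lambda>r. (r mod int p, r mod int q)) S"
  proof (rule inj_onI)
    fix r s assume rs: "r \<in> S" "s \<in> S"
      and "(r mod int p, r mod int q) = (s mod int p, s mod int q)"
    then have "[r = s] (mod int p * int q)"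
      using cop' by (intro coprime_cong_mult) (auto simp: cong_def)
    then show "r = s"
      using rs sub(1) by (auto simp: cong_def subset_iff)
  qed
  moreover have "(a, b) \<in> (\<lambda>r. (r mod int p, r mod int q)) ` S" if ab: "a \<in> A" "b \<in> B" for a b
  proof -
    obtain y where y: "[y = a] (mod int p)" "[y = b] (mod int q)"
      using binary_chinese_remainder_int[OF cop'] by blast
    define r where "r = y mod int (p * q)"
    have "r mod int p = a" "r mod int q = b"
      using y ab sub by (auto simp: r_def cong_def mod_mod_cancel)
    moreover have "r \<in> {0..<int (p * q)}"
      using pq by (simp add: r_def)
    ultimately show ?thesis
      using S ab by force
  qed
  ultimately show ?thesis
    using S sub(1) unfolding bij_betw_def by blast
qed

text \<open>Chinese remaindering turns multiplication by \<open>m\<close> into the componentwise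
  map. \<open>S\<close>, \<open>A\<close> and \<open>B\<close> are left general so that both the
  unit residues and all power residues are covered.\<close>

lemma sign_on_residue_mult_chinese_remainder:
  fixes p q :: nat
  assumes pq: "p > 1" "q > 1" and cop: "coprime p q" and m: "coprime m (p * q)"
    and sub: "S \<subseteq> {0..<int (p * q)}" "A \<subseteq> {0..<int p}" "B \<subseteq> {0..<int q}"
    and S: "\<And>r. r \<in> {0..<int (p * q)} \<Longrightarrow> r \<in> S \<longleftrightarrow> r mod int p \<in> A \<and> r mod int q \<in> B"
    and closed: "\<And>x. x \<in> A \<Longrightarrow> residue_mult m p x \<in> A" "\<And>x. x \<in> B \<Longrightarrow> residue_mult m q x \<in> B"
  shows "sign_on S (residue_mult m (p * q))
    = sign_on A (residue_mult m p) ^ card B * sign_on B (residue_mult m q) ^ card A"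
proof -
  have bij: "bij_betw (residue_mult m n) X X"
    if "n > 1" "coprime m n" "X \<subseteq> {0..<int n}" "\<And>x. x \<in> X \<Longrightarrow> residue_mult m n x \<in> X" for n X
  proof -
    have "restrict_id (residue_mult m n) X permutes X"
      using that by (intro residue_mult_permutes) (auto simp: residue_ring_def subset_iff)
    then show ?thesis
      by (intro bij_betw_cong[THEN iffD1, OF _ permutes_imp_bij]) auto
  qed
  have fin: "finite A" "finite B" "finite S"
    using sub finite_subset by blast+
  let ?h = "\<lambda>r. (r mod int p, r mod int q)"
  have h: "bij_betw ?h S (A \<times> B)"
    by (rule bij_betw_chinese_remainder) (use pq cop sub S in auto)
  have comm: "map_prod (residue_mult m p) (residue_mult m q) (?h r) = ?h (residue_mult m (p * q) r)" for r
    by (simp add: residue_mult_def mod_mult_right_eq mod_mod_cancel)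
  have "bij_betw (residue_mult m (p * q)) S S"
  proof (rule bij)
    show "p * q > 1" using pq by (metis less_1_mult)
    fix r assume r: "r \<in> S"
    have "residue_mult m (p * q) r \<in> {0..<int (p * q)}"
      using pq by (simp add: residue_mult_def)
    \<comment> \<open>Closure of \<open>S\<close> is inherited from that of \<open>A\<close> and
      \<open>B\<close> through the componentwise action.\<close>
    moreover have "?h (residue_mult m (p * q) r) \<in> A \<times> B"
      unfolding comm[symmetric] using r S sub(1) closed by auto
    ultimately show "residue_mult m (p * q) r \<in> S"
      using S by auto
  qed (use m sub in auto)
  then have "sign_on (A \<times> B) (map_prod (residue_mult m p) (residue_mult m q))
      = sign_on S (residue_mult m (p * q))"
    using h fin comm by (intro sign_on_bij_betw)
  moreover have "bij_betw (residue_mult m p) A A" "bij_betw (residue_mult m q) B B"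
    using pq m sub closed by (auto intro!: bij)
  ultimately show ?thesis
    using sign_on_map_prod_Times fin by metis
qed

text \<open>Roots \<open>u\<close> and \<open>v\<close> for the two moduli glue to one root
  \<open>y\<close> by Chinese remaindering.\<close>

lemma power_residue_mult_iff:
  fixes p q :: int
  assumes "coprime p q"
  shows "(\<exists>x. [x ^ d = r] (mod p * q))
    \<longleftrightarrow> (\<exists>x. [x ^ d = r mod p] (mod p)) \<and> (\<exists>x. [x ^ d = r mod q] (mod q))"
proof
  assume "\<exists>x. [x ^ d = r] (mod p * q)"
  then obtain x where "[x ^ d = r] (mod p * q)" by blast
  then have "[x ^ d = r] (mod p)" "[x ^ d = r] (mod q)"
    by (auto intro: cong_dvd_modulus)
  then show "(\<exists>x. [x ^ d = r mod p] (mod p)) \<and> (\<exists>x. [x ^ d = r mod q] (mod q))"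
    by auto
next
  assume "(\<exists>x. [x ^ d = r mod p] (mod p)) \<and> (\<exists>x. [x ^ d = r mod q] (mod q))"
  then obtain u v where uv: "[u ^ d = r] (mod p)" "[v ^ d = r] (mod q)" by auto
  obtain y where "[y = u] (mod p)" "[y = v] (mod q)"
    using binary_chinese_remainder_int[OF assms] by blast
  then have "[y ^ d = r] (mod p)" "[y ^ d = r] (mod q)"
    using uv cong_pow cong_trans by blast+
  then show "\<exists>x. [x ^ d = r] (mod p * q)"
    using assms coprime_cong_mult by blast
qed

section \<open>Comparison of the two signs with the symbol modulo \<open>N\<close>\<close>

theorem theorem6:
  fixes k p q N m :: nat
  assumes "k \<ge> 1"
    and "prime p" and "prime q" and "odd p" and "odd q" and "p \<noteq> q"
    and "N = p * q"
    and "coprime m N"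
    and "pow2_symbol_prime (k - 1) (int m) p = 1"
    and "pow2_symbol_prime (k - 1) (int m) q = 1"
  shows "pow2_symbol k (int m) N =
    (if [N = 1] (mod 2 ^ k)
     then sign (restrict_id (residue_mult m N) (pow2_residues N (k - 1)))
     else sign (restrict_id (residue_mult m N) (pow2_unit_residues N (k - 1))))"
proof -
  define j where "j = k - 1"
  have k: "k = Suc j" using assms(1) by (simp add: j_def)
  note p = \<open>prime p\<close> and q = \<open>prime q\<close>
  have p1: "p > 1" and q1: "q > 1" using p q prime_gt_1_nat by blast+
  have N1: "p * q > 1" using p1 q1 by (metis less_1_mult)
  have cop: "coprime p q" using p q \<open>p \<noteq> q\<close> by (rule primes_coprime)
  have m: "coprime m p" "coprime m q" "coprime m (p * q)" using assms(7,8) by auto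
  have sym: "pow2_symbol_prime j (int m) p = 1" "pow2_symbol_prime j (int m) q = 1"
    using assms(9,10) by (simp_all add: j_def)
  define s t where "s = pow2_symbol_prime k (int m) p" and "t = pow2_symbol_prime k (int m) q"
  define a b where "a = card (pow2_unit_residues p j)" and "b = card (pow2_unit_residues q j)"
  have closed: "residue_mult m r x \<in> pow2_unit_residues r j"
    if r: "prime r" "coprime m r" "pow2_symbol_prime j (int m) r = 1" "x \<in> pow2_unit_residues r j"
    for r x
  proof -
    have r1: "r > 1" using r(1) by (rule prime_gt_1_nat)
    obtain y :: int where "[y ^ 2 ^ j = int m] (mod int r)"
      using r(3) by (auto simp: pow2_symbol_prime_def split: if_splits)
    moreover have "coprime (residue_mult m r x) (int r)"
      using r(2,4) r1 by (simp add: pow2_unit_residues_eq residue_mult_def coprime_mod_left_iff)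
    ultimately show ?thesis
      using r(4) r1 residue_mult_power[of y j m r x]
      by (simp add: pow2_unit_residues_eq residue_mult_def)
  qed
  have closed0: "residue_mult m r x \<in> pow2_residues r j"
    if "prime r" "coprime m r" "pow2_symbol_prime j (int m) r = 1" "x \<in> pow2_residues r j" for r x
  proof (cases "x = 0")
    case True
    with that(4) show ?thesis by (simp add: residue_mult_def)
  next
    case False
    with that closed show ?thesis by (simp add: pow2_residues_prime(1))
  qed
  have sp: "sign_on (pow2_unit_residues p j) (residue_mult m p) = s"
    and sq: "sign_on (pow2_unit_residues q j) (residue_mult m q) = t"
    using sign_on_pow2_unit_residues_prime(1)[OF p m(1) sym(1)]
      sign_on_pow2_unit_residues_prime(1)[OF q m(2) sym(2)]
    by (simp_all only: s_def t_def k)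
  have res_iff: "(\<exists>x. [x ^ 2 ^ j = r] (mod int (p * q)))
      \<longleftrightarrow> (\<exists>x. [x ^ 2 ^ j = r mod int p] (mod int p)) \<and> (\<exists>x. [x ^ 2 ^ j = r mod int q] (mod int q))"
    for r :: int
    using power_residue_mult_iff[of "int p" "int q" "2 ^ j" r] cop by simp
  have unit: "sign_on (pow2_unit_residues N j) (residue_mult m N) = s ^ b * t ^ a"
    unfolding \<open>N = p * q\<close> a_def b_def sp[symmetric] sq[symmetric]
  proof (rule sign_on_residue_mult_chinese_remainder[OF p1 q1 cop m(3)])
    fix r assume "r \<in> {0..<int (p * q)}"
    then show "r \<in> pow2_unit_residues (p * q) j
        \<longleftrightarrow> r mod int p \<in> pow2_unit_residues p j \<and> r mod int q \<in> pow2_unit_residues q j"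
      unfolding pow2_unit_residues_eq[OF p1] pow2_unit_residues_eq[OF q1]
        pow2_unit_residues_eq[OF N1] mem_Collect_eq res_iff
      using p1 q1 by (auto simp: coprime_mod_left_iff)
  qed (intro pow2_unit_residues_subset p1 q1 N1 closed p q m sym; assumption)+
  have full: "sign_on (pow2_residues N j) (residue_mult m N) = s ^ Suc b * t ^ Suc a"
  proof -
    \<comment> \<open>Including 0 raises each cardinality by one, which flips the parity of the
      exponents of \<open>s\<close> and \<open>t\<close> relative to the unit case.\<close>
    have "card (pow2_residues p j) = Suc a" "card (pow2_residues q j) = Suc b"
      using pow2_residues_prime[OF p, of j] pow2_residues_prime[OF q, of j] p1 q1
      by (simp_all add: a_def b_def finite_pow2_unit_residues)
    moreover have "sign_on (pow2_residues N j) (residue_mult m N)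
        = sign_on (pow2_residues p j) (residue_mult m p) ^ card (pow2_residues q j)
        * sign_on (pow2_residues q j) (residue_mult m q) ^ card (pow2_residues p j)"
      unfolding \<open>N = p * q\<close>
    proof (rule sign_on_residue_mult_chinese_remainder[OF p1 q1 cop m(3)])
      fix r assume "r \<in> {0..<int (p * q)}"
      then show "r \<in> pow2_residues (p * q) j
          \<longleftrightarrow> r mod int p \<in> pow2_residues p j \<and> r mod int q \<in> pow2_residues q j"
        unfolding pow2_residues_eq mem_Collect_eq res_iff
        using p1 q1 by auto
    qed (intro pow2_residues_subset closed0 p q m sym; assumption)+
    ultimately show ?thesis
      by (simp only: sign_on_pow2_residues_prime p q sp sq)
  qed
  have even: "even a \<longleftrightarrow> [p = 1] (mod 2 ^ k)" "even b \<longleftrightarrow> [q = 1] (mod 2 ^ k)"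
    using even_card_pow2_unit_residues_iff[OF p, of j] even_card_pow2_unit_residues_iff[OF q, of j]
    by (simp_all only: a_def b_def k)
  have st: "s = 1 \<or> s = -1" "t = 1 \<or> t = -1"
    by (auto simp: s_def t_def pow2_symbol_prime_def)
  have s1: "s = 1" if "odd a"
    using sign_on_pow2_unit_residues_prime(2)[OF p m(1) sym(1)] that by (simp add: sp a_def)
  have t1: "t = 1" if "odd b"
    using sign_on_pow2_unit_residues_prime(2)[OF q m(2) sym(2)] that by (simp add: sq b_def)
  have symbol: "pow2_symbol k (int m) N = s * t"
    using p q by (simp add: pow2_symbol_def \<open>N = p * q\<close> prime_factorization_mult
        prime_factorization_prime s_def t_def)
  \<comment> \<open>Once one prime is 1 modulo \<open>2 ^ k\<close>, \<open>N\<close> is congruent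
    to the other prime, whose parity criterion then decides whether \<open>N\<close> is 1.\<close>
  have "[N = q] (mod 2 ^ k)" if "even a"
    using cong_scalar_right[of p 1 "2 ^ k" q] even(1) that by (simp add: \<open>N = p * q\<close>)
  then have Na: "[N = 1] (mod 2 ^ k) \<longleftrightarrow> even b" if "even a"
    using that even(2) by (meson cong_sym cong_trans)
  have "[N = p] (mod 2 ^ k)" if "even b"
    using cong_scalar_left[of q 1 "2 ^ k" p] even(2) that by (simp add: \<open>N = p * q\<close>)
  then have Nb: "[N = 1] (mod 2 ^ k) \<longleftrightarrow> even a" if "even b"
    using that even(1) by (meson cong_sym cong_trans)
  show ?thesis
  proof (cases "[N = 1] (mod 2 ^ k)")
    case True
    \<comment> \<open>Now \<open>a\<close> and \<open>b\<close> have equal parity: if both are even,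
      the exponents \<open>Suc b\<close> and \<open>Suc a\<close> are odd; if both are odd,
      \<open>s = t = 1\<close>.\<close>
    then have "s * t = s ^ Suc b * t ^ Suc a"
      using Na Nb st s1 t1 by (cases "even a"; cases "even b") auto
    with True show ?thesis
      using full by (simp add: symbol sign_on_def j_def)
  next
    case False
    \<comment> \<open>Now \<open>a\<close> and \<open>b\<close> are not both even. A symbol equal to
      -1 forces its own group to have even order, so its exponent, the order of the other group, is
      odd.\<close>
    then have "s * t = s ^ b * t ^ a"
      using Na Nb st s1 t1 by (cases "even a"; cases "even b") auto
    with False show ?thesis
      using unit by (simp add: symbol sign_on_def j_def)
  qed
qed

end
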